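(* Let $\ell$ be a one-dimensional Lévy process with characteristic function $\phi_\ell$ and let $\Delta_n>0$ be a fixed time step. Let $F_{\Delta_n}$, the CDF of the distribution with characteristic function $(\phi_\ell)^{\Delta_n}$, be continuously differentiable on $\mathbb{R}$ with density $f_{\Delta_n}$. Assume that there are constants $R>0$, $\eta>2$, $B>0$, $\theta>0$ such that $|f_{\Delta_n}(x)|\le R|x|^{-\eta}$ for all $x\in\mathbb{R}$ and $|(\phi_\ell(u))^{\Delta_n}|\le B|u/(2\pi)|^{-\theta}$ for all $u\in\mathbb{R}$. Furthermore, assume that the approximation parameters $D$ and $\varepsilon$ fulfill $D=C\varepsilon^{-d}$ for $C,d>0$. Then for all $p\in[1,\eta-1)$ with $d<\frac1p$, $$\mathbb{E}\big(|\widetilde X-X|^p\big)\to0\quad\text{as }\varepsilon\to0 .$$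
   Context: $\mathbb{E}[\exp(iu\ell(t))]=(\phi_\ell(u))^t$. Approximated CDF: for an even integer $M$ and $\kappa,J>0$, $\widetilde F_{\Delta_n}(x):=\sum_{k=-M/2}^{M/2}q_k\exp(i2\pi kx/J)$, where $q_0=1/2$, $q_k=\frac{1-\cos(2\pi\kappa k)}{i2\pi k}(\phi_\ell(-2\pi k/J))^{\Delta_n}$ for $0<|k|<M/2$, and $q_k=0$ for $|k|=M/2$; it is real-valued. For $D,\varepsilon>0$ the parameters $0<\kappa<2/3$, $J\ge D/\kappa$ and $M$ are chosen such that $|F_{\Delta_n}(x)-\widetilde F_{\Delta_n}(x)|<\varepsilon$ for all $x\in[-D/2,D/2]$ (under the stated bounds such a choice is always possible, by a known theorem of Hughett). $X$ is a random variable on $(\Omega,(\mathcal{A}_t,t\ge0),\mathbb{P})$ with CDF $F_{\Delta_n}$ (an increment of $\ell$ over a time step $\Delta_n$), $U:=F_{\Delta_n}(X)\sim\mathcal{U}([0,1])$, and $\widetilde X:=\widetilde F_{\Delta_n}^{-1}(U)$, where $\widetilde F_{\Delta_n}^{-1}(u):=-D/2$ if $u<\min\widetilde F_{\Delta_n}([-D/2,D/2])$; $\widetilde F_{\Delta_n}^{-1}(u):=D/2$ if $u>\max\widetilde F_{\Delta_n}([-D/2,D/2])$; and $\widetilde F_{\Delta_n}^{-1}(u):=\inf\{x\in[-D/2,D/2]:\widetilde F_{\Delta_n}(x)=u\}$ otherwise. *)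

theory Defs
  imports "HOL-Probability.Probability"
begin

subsection \<open>Levy processes\<close>

locale levy_process = prob_space M for M :: "'a measure" +
  fixes L :: "real \<Rightarrow> 'a \<Rightarrow> real"
  assumes random_variable: "\<And>t. 0 \<le> t \<Longrightarrow> L t \<in> borel_measurable M"
    and start: "AE \<omega> in M. L 0 \<omega> = 0"
    and independent_increments:
      "\<And>(\<tau> :: nat \<Rightarrow> real) n. 0 \<le> \<tau> 0 \<Longrightarrow> (\<And>i. i < n \<Longrightarrow> \<tau> i \<le> \<tau> (Suc i)) \<Longrightarrow>
         indep_vars (\<lambda>_. borel) (\<lambda>i \<omega>. L (\<tau> (Suc i)) \<omega> - L (\<tau> i) \<omega>) {..<n}"
    and stationary_increments:
      "\<And>s t. 0 \<le> s \<Longrightarrow> 0 \<le> t \<Longrightarrow>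
         distr M borel (\<lambda>\<omega>. L (s + t) \<omega> - L s \<omega>) = distr M borel (\<lambda>\<omega>. L t \<omega> - L 0 \<omega>)"
    and stochastically_continuous:
      "\<And>t e. 0 \<le> t \<Longrightarrow> 0 < e \<Longrightarrow>
         ((\<lambda>s. prob {\<omega> \<in> space M. e < \<bar>L s \<omega> - L t \<omega>\<bar>}) \<longlongrightarrow> 0) (at t within {0..})"

subsection \<open>Real powers of a characteristic function\<close>

text \<open>
  For an infinitely divisible characteristic function \<open>\<phi>\<close> and real \<open>t\<close>, the power
  \<open>(\<phi> u)\<^sup>t\<close> is \<open>exp (t * \<psi> u)\<close> for the continuous logarithm \<open>\<psi>\<close> of \<open>\<phi>\<close> with
  \<open>\<psi> 0 = 0\<close>. The principal branch would be wrong, because \<open>\<phi> u\<close> may wind around \<open>0\<close>.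
\<close>

definition cf_log :: "(real \<Rightarrow> complex) \<Rightarrow> real \<Rightarrow> complex" where
  "cf_log \<phi> = (THE \<psi>. continuous_on UNIV \<psi> \<and> \<psi> 0 = 0 \<and> (\<forall>u. \<phi> u = exp (\<psi> u)))"

definition cf_power :: "(real \<Rightarrow> complex) \<Rightarrow> real \<Rightarrow> real \<Rightarrow> complex" where
  "cf_power \<phi> t u = exp (complex_of_real t * cf_log \<phi> u)"

lemma cf_log_unique:
  fixes \<psi> \<psi>' :: "real \<Rightarrow> complex"
  assumes c: "continuous_on UNIV \<psi>" "continuous_on UNIV \<psi>'"
    and z: "\<psi> 0 = \<psi>' 0" and e: "\<And>u. exp (\<psi> u) = exp (\<psi>' u)"
  shows "\<psi> = \<psi>'"
proof -
  define g where "g = (\<lambda>u. (\<psi> u - \<psi>' u) / (2 * of_real pi * \<i>))"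
  have gZ: "g u \<in> \<int>" for u
  proof -
    have "exp (\<psi> u) = exp (\<psi>' u)" by (rule e)
    then obtain n :: int where "\<psi> u = \<psi>' u + (of_int (2 * n) * pi) * \<i>"
      by (auto simp: exp_eq)
    then have "g u = of_int n" by (simp add: g_def)
    then show ?thesis by simp
  qed
  have "continuous_on UNIV g"
    unfolding g_def by (intro continuous_intros c) auto
  moreover have "\<exists>e>0. \<forall>y. y \<in> UNIV \<and> g y \<noteq> g x \<longrightarrow> e \<le> norm (g y - g x)" for x
  proof (intro exI[of _ 1] conjI allI impI)
    fix y assume *: "y \<in> UNIV \<and> g y \<noteq> g x"
    obtain a b :: int where "g y = of_int a" "g x = of_int b"
      using gZ by (metis Ints_cases)
    then have "g y - g x = of_int (a - b)" and "a \<noteq> b"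
      using * by auto
    then have "norm (g y - g x) = \<bar>real_of_int (a - b)\<bar>" by (metis norm_of_int)
    also have "\<dots> \<ge> 1" using \<open>a \<noteq> b\<close> by linarith
    finally show "1 \<le> norm (g y - g x)" .
  qed simp
  ultimately have "g constant_on UNIV"
    by (intro continuous_discrete_range_constant) auto
  then have "g u = g 0" for u
    by (auto simp: constant_on_def)
  then have "g u = 0" for u using z by (simp add: g_def)
  then show ?thesis by (auto simp: g_def fun_eq_iff)
qed

lemma cf_log_eqI:
  assumes "continuous_on UNIV \<psi>" "\<psi> 0 = 0" "\<And>u. \<phi> u = exp (\<psi> u)"
  shows "cf_log \<phi> = \<psi>"
  unfolding cf_log_def
proof (rule the_equality)
  fix \<psi>' assume *: "continuous_on UNIV \<psi>' \<and> \<psi>' 0 = 0 \<and> (\<forall>u. \<phi> u = exp (\<psi>' u))"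
  show "\<psi>' = \<psi>"
    by (rule cf_log_unique) (use assms * in \<open>auto\<close>)
qed (use assms in auto)

lemma cf_log_exists:
  fixes \<phi> :: "real \<Rightarrow> complex"
  assumes "continuous_on UNIV \<phi>" "\<phi> 0 = 1" "\<And>u. \<phi> u \<noteq> 0"
  obtains \<psi> where "continuous_on UNIV \<psi>" "\<psi> 0 = 0" "\<And>u. \<phi> u = exp (\<psi> u)"
proof -
  obtain g where g: "continuous_on UNIV g" "\<And>u. \<phi> u = exp (g u)"
    using continuous_logarithm_on_contractible[of UNIV \<phi>] assms contractible_UNIV by auto
  show ?thesis
  proof (rule that[of "\<lambda>u. g u - g 0"])
    show "continuous_on UNIV (\<lambda>u. g u - g 0)" by (intro continuous_intros g)
    show "\<phi> u = exp (g u - g 0)" for u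
      using g(2)[of 0] assms(2) by (simp add: exp_diff g(2))
  qed simp
qed

context levy_process
begin

definition increment_cf :: "real \<Rightarrow> real \<Rightarrow> complex" where
  "increment_cf t = char (distr M borel (\<lambda>\<omega>. L t \<omega> - L 0 \<omega>))"

lemma increment_cf_eq_integral:
  "0 \<le> t \<Longrightarrow> increment_cf t u = (CLINT \<omega>|M. iexp (u * (L t \<omega> - L 0 \<omega>)))"
  unfolding increment_cf_def char_def
  by (subst integral_distr) (auto intro!: borel_measurable_diff random_variable)

lemma increment_cf_eq: "0 \<le> t \<Longrightarrow> increment_cf t = char (distr M borel (L t))"
  unfolding increment_cf_def
  by (rule arg_cong[where f=char], rule distr_cong_AE)
     (use start in \<open>auto intro!: random_variable borel_measurable_diff\<close>)

lemma increment_cf_mult: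
  assumes h: "0 \<le> h"
  shows "increment_cf (real n * h) u = increment_cf h u ^ n"
proof -
  define Y where "Y = (\<lambda>(i::nat) \<omega>. L (real (Suc i) * h) \<omega> - L (real i * h) \<omega>)"
  have "indep_vars (\<lambda>_. borel) Y {..<n}"
    unfolding Y_def
    by (rule independent_increments[of "\<lambda>i. real i * h"])
       (use h in \<open>auto simp: algebra_simps\<close>)
  from char_distr_sum[OF this]
  have "char (distr M borel (\<lambda>\<omega>. \<Sum>i<n. Y i \<omega>)) u = (\<Prod>i<n. char (distr M borel (Y i)) u)" .
  moreover have "(\<Sum>i<n. Y i \<omega>) = L (real n * h) \<omega> - L 0 \<omega>" for \<omega>
    unfolding Y_def by (subst sum_lessThan_telescope) simp
  moreover have "char (distr M borel (Y i)) = increment_cf h" for i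
    using stationary_increments[of "real i * h" h] h
    by (simp add: Y_def increment_cf_def algebra_simps)
  ultimately show ?thesis by (simp add: increment_cf_def)
qed

lemma real_distribution_increment:
  "0 \<le> t \<Longrightarrow> real_distribution (distr M borel (\<lambda>\<omega>. L t \<omega> - L 0 \<omega>))"
  by (intro real_distribution_distr borel_measurable_diff random_variable) auto

lemma continuous_on_increment_cf: "0 \<le> t \<Longrightarrow> continuous_on A (increment_cf t)"
  unfolding increment_cf_def
  by (intro continuous_at_imp_continuous_on ballI real_distribution.isCont_char
      real_distribution_increment)

lemma increment_cf_zero_right: "0 \<le> t \<Longrightarrow> increment_cf t 0 = 1"
  unfolding increment_cf_def
  by (rule real_distribution.char_zero) (rule real_distribution_increment)

lemma increment_cf_zero_left: "increment_cf 0 u = 1"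
  using increment_cf_mult[of 0 0 u] by simp

lemma norm_increment_cf_diff:
  assumes "0 \<le> s" "0 \<le> t" "0 < e"
  shows "norm (increment_cf s u - increment_cf t u)
    \<le> \<bar>u\<bar> * e + 2 * prob {\<omega> \<in> space M. e < \<bar>L s \<omega> - L t \<omega>\<bar>}"
proof -
  note [measurable] = random_variable[OF assms(1)] random_variable[OF assms(2)]
    random_variable[OF order_refl]
  let ?A = "{\<omega> \<in> space M. e < \<bar>L s \<omega> - L t \<omega>\<bar>}"
  let ?f = "\<lambda>t \<omega>. iexp (u * (L t \<omega> - L 0 \<omega>))"
  have int: "integrable M (?f t)" "integrable M (?f s)"
    by (rule integrable_iexp; simp)+
  have "increment_cf s u - increment_cf t u = (CLINT \<omega>|M. ?f s \<omega> - ?f t \<omega>)"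
    using int assms by (simp add: increment_cf_eq_integral)
  also have "norm \<dots> \<le> (\<integral>\<omega>. norm (?f s \<omega> - ?f t \<omega>) \<partial>M)"
    by (rule integral_norm_bound)
  also have "\<dots> \<le> (\<integral>\<omega>. \<bar>u\<bar> * e + 2 * indicator ?A \<omega> \<partial>M)"
  proof (rule integral_mono)
    show "integrable M (\<lambda>\<omega>. norm (?f s \<omega> - ?f t \<omega>))"
      using int by (intro integrable_norm Bochner_Integration.integrable_diff)
    show "integrable M (\<lambda>\<omega>. \<bar>u\<bar> * e + 2 * indicator ?A \<omega>)"
      by (intro Bochner_Integration.integrable_add integrable_mult_right integrable_const
          integrable_real_indicator) (auto simp: less_top[symmetric])
    fix \<omega> assume \<omega>: "\<omega> \<in> space M"
    show "norm (?f s \<omega> - ?f t \<omega>) \<le> \<bar>u\<bar> * e + 2 * indicator ?A \<omega>"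
    proof (cases "\<omega> \<in> ?A")
      case True
      have "norm (?f s \<omega> - ?f t \<omega>) \<le> norm (?f s \<omega>) + norm (?f t \<omega>)"
        by (rule norm_triangle_ineq4)
      also have "\<dots> = 2" by (simp del: of_real_mult of_real_diff)
      also have "\<dots> \<le> \<bar>u\<bar> * e + 2" using assms by simp
      finally show ?thesis using True by simp
    next
      case False
      have "?f s \<omega> - ?f t \<omega> = ?f t \<omega> * (iexp (u * (L s \<omega> - L t \<omega>)) - 1)"
        by (simp add: algebra_simps flip: exp_add)
      then have "norm (?f s \<omega> - ?f t \<omega>) = norm (iexp (u * (L s \<omega> - L t \<omega>)) - 1)"
        by (simp add: norm_mult del: of_real_mult of_real_diff)
      also have "\<dots> \<le> \<bar>u * (L s \<omega> - L t \<omega>)\<bar>"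
        using iexp_approx1[of "u * (L s \<omega> - L t \<omega>)" 0] by simp
      also have "\<dots> \<le> \<bar>u\<bar> * e"
        using False \<omega> by (simp add: abs_mult mult_left_mono)
      finally show ?thesis using False by simp
    qed
  qed
  also have "\<dots> = \<bar>u\<bar> * e + 2 * prob ?A"
    by (subst Bochner_Integration.integral_add) (auto simp: prob_space less_top[symmetric])
  finally show ?thesis .
qed

lemma increment_cf_tendsto:
  assumes t: "0 \<le> t"
  shows "((\<lambda>s. increment_cf s u) \<longlongrightarrow> increment_cf t u) (at t within {0..})"
  unfolding tendsto_iff
proof (intro allI impI)
  fix r :: real assume r: "0 < r"
  define e where "e = r / (2 * (\<bar>u\<bar> + 1))"
  have e: "0 < e" and ue: "\<bar>u\<bar> * e < r / 2"
    using r by (auto simp: e_def field_simps intro: add_pos_nonneg)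
  have "\<forall>\<^sub>F s in at t within {0..}. dist (prob {\<omega> \<in> space M. e < \<bar>L s \<omega> - L t \<omega>\<bar>}) 0 < r / 4"
    using tendstoD[OF stochastically_continuous[OF t e], of "r / 4"] r by simp
  moreover have "\<forall>\<^sub>F s in at t within {0..}. s \<in> {0..}"
    by (auto simp: eventually_at_filter)
  ultimately show "\<forall>\<^sub>F s in at t within {0..}. dist (increment_cf s u) (increment_cf t u) < r"
  proof eventually_elim
    case (elim s)
    then show ?case
      using norm_increment_cf_diff[of s t e u] t e ue by (simp add: dist_norm)
  qed
qed

lemma continuous_on_increment_cf_time: "continuous_on {0..} (\<lambda>t. increment_cf t u)"
  using increment_cf_tendsto by (simp add: continuous_on_def)

lemma increment_cf_nonzero:
  assumes t: "0 \<le> t"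
  shows "increment_cf t u \<noteq> 0"
proof
  assume z: "increment_cf t u = 0"
  have "increment_cf (t / real (Suc n)) u = 0" for n
    using increment_cf_mult[of "t / real (Suc n)" "Suc n" u] t z
    by (simp del: of_nat_Suc power_Suc)
  moreover have "(\<lambda>n. increment_cf (t / real (Suc n)) u) \<longlonglongrightarrow> increment_cf 0 u"
    by (rule continuous_on_tendsto_compose[OF continuous_on_increment_cf_time])
       (use t in \<open>auto intro!: real_tendsto_divide_at_top tendsto_const filterlim_compose[OF
          filterlim_real_sequentially filterlim_Suc] simp del: of_nat_Suc\<close>)
  ultimately show False by (simp add: increment_cf_zero_left LIMSEQ_const_iff)
qed

lemma increment_cf_eq_cf_power:
  assumes t: "0 \<le> t"
  shows "increment_cf t u = cf_power (increment_cf 1) t u"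
proof -
  define \<psi> where "\<psi> t = cf_log (increment_cf t)" for t
  have \<psi>: "continuous_on UNIV (\<psi> t)" "\<psi> t 0 = 0" "increment_cf t u = exp (\<psi> t u)"
    if t: "0 \<le> t" for t u
  proof -
    obtain g where g: "continuous_on UNIV g" "g 0 = 0" "\<And>u. increment_cf t u = exp (g u)"
      using cf_log_exists[of "increment_cf t"] continuous_on_increment_cf[OF t]
        increment_cf_zero_right[OF t] increment_cf_nonzero[OF t] by blast
    moreover have "\<psi> t = g" unfolding \<psi>_def by (rule cf_log_eqI) (use g in auto)
    ultimately show "continuous_on UNIV (\<psi> t)" "\<psi> t 0 = 0" "increment_cf t u = exp (\<psi> t u)"
      by auto
  qed
  have mult: "\<psi> (real n * h) u = of_nat n * \<psi> h u" if h: "0 \<le> h" for n h u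
  proof -
    have nh: "0 \<le> real n * h" using h by simp
    have "\<psi> (real n * h) = (\<lambda>u. of_nat n * \<psi> h u)"
    proof (rule cf_log_unique)
      show "exp (\<psi> (real n * h) u) = exp (of_nat n * \<psi> h u)" for u
        unfolding \<psi>(3)[OF nh, symmetric] increment_cf_mult[OF h]
        by (simp add: exp_of_nat_mult \<psi>(3)[OF h])
    qed (use \<psi>[OF nh] \<psi>[OF h] in \<open>auto intro!: continuous_intros\<close>)
    then show ?thesis by simp
  qed
  have rat: "increment_cf (real m / real (Suc n)) u = exp (of_real (real m / real (Suc n)) * \<psi> 1 u)"
    for m n
  proof -
    have "\<psi> 1 u = of_nat (Suc n) * \<psi> (1 / real (Suc n)) u"
      using mult[of "1 / real (Suc n)" "Suc n" u] by (simp del: of_nat_Suc)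
    moreover have "\<psi> (real m / real (Suc n)) u = of_nat m * \<psi> (1 / real (Suc n)) u"
      using mult[of "1 / real (Suc n)" m u] by (simp del: of_nat_Suc)
    ultimately have "\<psi> (real m / real (Suc n)) u = of_real (real m / real (Suc n)) * \<psi> 1 u"
      by (simp add: field_simps del: of_nat_Suc)
    then show ?thesis by (subst \<psi>(3)) auto
  qed
  define q where "q n = real (nat \<lfloor>t * real (Suc n)\<rfloor>) / real (Suc n)" for n
  have q: "q \<longlonglongrightarrow> t"
  proof (rule tendsto_sandwich[of "\<lambda>n. t - 1 / real (Suc n)" q _ "\<lambda>_. t"])
    have "t - 1 / real (Suc n) \<le> q n \<and> q n \<le> t" for n
    proof -
      have *: "real (nat \<lfloor>t * real (Suc n)\<rfloor>) = of_int \<lfloor>t * real (Suc n)\<rfloor>"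
        using t by simp
      have "t * real (Suc n) - 1 \<le> real (nat \<lfloor>t * real (Suc n)\<rfloor>)"
        "real (nat \<lfloor>t * real (Suc n)\<rfloor>) \<le> t * real (Suc n)"
        unfolding * by linarith+
      then have "(t * real (Suc n) - 1) / real (Suc n) \<le> q n" "q n \<le> t * real (Suc n) / real (Suc n)"
        unfolding q_def by (intro divide_right_mono; simp del: of_nat_Suc)+
      then show ?thesis by (simp add: diff_divide_distrib del: of_nat_Suc)
    qed
    then show "\<forall>\<^sub>F n in sequentially. t - 1 / real (Suc n) \<le> q n"
      "\<forall>\<^sub>F n in sequentially. q n \<le> t" by auto
    show "(\<lambda>n. t - 1 / real (Suc n)) \<longlonglongrightarrow> t"
      using tendsto_diff[OF tendsto_const[of t] LIMSEQ_inverse_real_of_nat]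
      by (simp add: inverse_eq_divide)
  qed simp
  have "(\<lambda>n. increment_cf (q n) u) \<longlonglongrightarrow> increment_cf t u"
    by (rule continuous_on_tendsto_compose[OF continuous_on_increment_cf_time q])
       (use t in \<open>auto simp: q_def\<close>)
  moreover have "(\<lambda>n. increment_cf (q n) u) \<longlonglongrightarrow> exp (of_real t * \<psi> 1 u)"
    unfolding q_def rat unfolding q_def[symmetric] by (intro tendsto_intros q)
  ultimately show ?thesis
    unfolding cf_power_def \<psi>_def by (rule LIMSEQ_unique)
qed

text \<open>The identity \<open>\<bbbE>[exp (i u L(t))] = (\<phi> u)\<^sup>t\<close>, which justifies the definition of the power.\<close>

theorem char_eq_cf_power:
  assumes "0 \<le> t"
  shows "char (distr M borel (L t)) = cf_power (char (distr M borel (L 1))) t"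
  using increment_cf_eq_cf_power[OF assms] assms
  by (auto simp: increment_cf_eq fun_eq_iff)

end

subsection \<open>The Fourier approximation of the CDF\<close>

text \<open>The argument \<open>g\<close> is the characteristic function of the distribution to be approximated.\<close>

definition fourier_coeff ::
  "(real \<Rightarrow> complex) \<Rightarrow> real \<Rightarrow> real \<Rightarrow> nat \<Rightarrow> int \<Rightarrow> complex" where
  "fourier_coeff g \<kappa> J N k =
     (if k = 0 then 1 / 2
      else if \<bar>k\<bar> < int (N div 2) then
        (1 - complex_of_real (cos (2 * pi * \<kappa> * of_int k))) / (\<i> * complex_of_real (2 * pi * of_int k))
          * g (- (2 * pi * of_int k / J))
      else 0)"

definition approx_cdf_complex ::
  "(real \<Rightarrow> complex) \<Rightarrow> real \<Rightarrow> real \<Rightarrow> nat \<Rightarrow> real \<Rightarrow> complex" where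
  "approx_cdf_complex g \<kappa> J N x =
     (\<Sum>k\<in>{- int (N div 2)..int (N div 2)}.
        fourier_coeff g \<kappa> J N k * exp (\<i> * complex_of_real (2 * pi * of_int k * x / J)))"

text \<open>The sum is real (lemma \<open>of_real_approx_cdf\<close>), so taking the real part loses nothing.\<close>

definition approx_cdf ::
  "(real \<Rightarrow> complex) \<Rightarrow> real \<Rightarrow> real \<Rightarrow> nat \<Rightarrow> real \<Rightarrow> real" where
  "approx_cdf g \<kappa> J N x = Re (approx_cdf_complex g \<kappa> J N x)"

lemma char_uminus: "char \<mu> (- u) = cnj (char \<mu> u)"
  unfolding char_def Bochner_Integration.integral_cnj[symmetric]
  by (simp add: exp_cnj)

lemma of_real_approx_cdf:
  "complex_of_real (approx_cdf (char \<mu>) \<kappa> J N x) = approx_cdf_complex (char \<mu>) \<kappa> J N x"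
proof -
  let ?a = "\<lambda>k. fourier_coeff (char \<mu>) \<kappa> J N k * exp (\<i> * complex_of_real (2 * pi * of_int k * x / J))"
  let ?S = "{- int (N div 2)..int (N div 2)}"
  have c: "cnj (?a k) = ?a (- k)" for k
    using char_uminus[of \<mu> "2 * pi * of_int k / J"]
    by (auto simp: fourier_coeff_def exp_cnj)
  have "cnj (\<Sum>k\<in>?S. ?a k) = (\<Sum>k\<in>?S. ?a (- k))"
    by (simp only: cnj_sum c)
  also have "\<dots> = (\<Sum>k\<in>?S. ?a k)"
    by (rule sum.reindex_bij_witness[of _ uminus uminus]) auto
  finally have "cnj (approx_cdf_complex (char \<mu>) \<kappa> J N x) = approx_cdf_complex (char \<mu>) \<kappa> J N x"
    by (simp only: approx_cdf_complex_def)
  then show ?thesis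
    by (simp add: approx_cdf_def complex_eq_iff)
qed

subsection \<open>The generalised inverse of the approximation\<close>

text \<open>
  \<open>G\<close> is continuous in the application, so the infimum and supremum of its image of the
  compact interval are the minimum and maximum.
\<close>

definition approx_inverse :: "(real \<Rightarrow> real) \<Rightarrow> real \<Rightarrow> real \<Rightarrow> real" where
  "approx_inverse G D u =
     (if u < Inf (G ` {-D/2..D/2}) then - D / 2
      else if u > Sup (G ` {-D/2..D/2}) then D / 2
      else Inf {x \<in> {-D/2..D/2}. G x = u})"

end

theory Submission
  imports Defs "HOL-Real_Asymp.Real_Asymp"
begin

text \<open>
  Write \<open>Y\<close> for the approximation \<open>X_approx \<epsilon>\<close>. On the event \<open>\<bar>X\<bar> \<le> D/2\<close>, the accuracy of the
  approximated CDF gives \<open>\<bar>F Y - F X\<bar> < \<epsilon>\<close>. Almost surely \<open>F\<close> is strictly increasing at \<open>X\<close>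
  (otherwise \<open>F X\<close> lies in the countable set \<open>F(\<rat>)\<close>), so \<open>Y\<close> tends to \<open>X\<close>. The density bound gives
  \<open>\<bar>x\<bar>\<^sup>p \<le> K\<^sup>a ((F x)\<^sup>-\<^sup>a + (1 - F x)\<^sup>-\<^sup>a)\<close> with \<open>a = p/(\<eta> - 1) < 1\<close>. If \<open>2\<epsilon> \<le> F X \<le> 1 - 2\<epsilon>\<close>, then \<open>F Y\<close> and
  \<open>1 - F Y\<close> are at least half of \<open>F X\<close> and \<open>1 - F X\<close>, so up to a constant the right-hand side at \<open>X\<close>
  dominates \<open>\<bar>Y - X\<bar>\<^sup>p\<close>; it is integrable because \<open>F X\<close> is uniform. The same domination holds when
  \<open>\<bar>X\<bar> > D/2\<close>, as then \<open>\<bar>Y\<bar> \<le> \<bar>X\<bar>\<close>. The remaining event has probability at most \<open>4\<epsilon>\<close> and there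
  \<open>\<bar>Y - X\<bar> \<le> D\<close>, which contributes at most \<open>4\<epsilon> D\<^sup>p = 4C\<^sup>p \<epsilon>\<^bsup>1 - dp\<^esup>\<close>.
\<close>

section \<open>Power inequalities, tails from densities, and integrability of negative
  powers\<close>

lemma abs_diff_powr_le:
  fixes x y :: real
  assumes "0 \<le> p"
  shows "\<bar>x - y\<bar> powr p \<le> 2 powr p * (\<bar>x\<bar> powr p + \<bar>y\<bar> powr p)"
proof -
  have "\<bar>x - y\<bar> powr p \<le> (2 * max \<bar>x\<bar> \<bar>y\<bar>) powr p"
    by (rule powr_mono2) (use assms in auto)
  also have "\<dots> = 2 powr p * max \<bar>x\<bar> \<bar>y\<bar> powr p"
    by (rule powr_mult)
  also have "\<dots> \<le> 2 powr p * (\<bar>x\<bar> powr p + \<bar>y\<bar> powr p)"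
    by (intro mult_left_mono) (auto simp: max_def)
  finally show ?thesis .
qed

text \<open>Subtracting the claimed bound from \<open>T\<close> leaves a function with derivative
  \<open>T' y + R * y powr (- \<eta>)\<close>, which is nonnegative. So the difference is
  nondecreasing, and since it tends to 0 at infinity it is at most 0. It serves for both tails of
  \<open>F\<close>, whose derivatives are controlled by the density.\<close>

lemma tail_le_powr_of_deriv:
  fixes T T' :: "real \<Rightarrow> real"
  assumes deriv: "\<And>x. 0 < x \<Longrightarrow> (T has_real_derivative T' x) (at x)"
    and bound: "\<And>x. 0 < x \<Longrightarrow> \<bar>T' x\<bar> \<le> R * x powr (- \<eta>)"
    and lim: "(T \<longlongrightarrow> 0) at_top"
    and \<eta>: "1 < \<eta>" and x: "0 < x"
  shows "T x \<le> R / (\<eta> - 1) * x powr (- (\<eta> - 1))"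
proof -
  define h where "h y = T y - R / (\<eta> - 1) * y powr (- (\<eta> - 1))" for y
  have deriv_h: "(h has_real_derivative (T' y + R * y powr (- \<eta>))) (at y)" if "0 < y" for y
    unfolding h_def
    by (rule derivative_eq_intros deriv that refl)+
       (use \<eta> that in \<open>auto simp: field_simps\<close>)
  have mono: "h x \<le> h y" if "x \<le> y" for y
  proof (rule DERIV_nonneg_imp_nondecreasing[OF that])
    fix z assume "x \<le> z" "z \<le> y"
    then have "0 < z" using x by simp
    then show "\<exists>D. (h has_real_derivative D) (at z) \<and> 0 \<le> D"
      using deriv_h[of z] bound[of z] by (intro exI[of _ "T' z + R * z powr (- \<eta>)"]) auto
  qed
  have "((\<lambda>y. y powr (- (\<eta> - 1))) \<longlongrightarrow> 0) at_top"
    by (rule tendsto_neg_powr) (use \<eta> in \<open>auto intro: filterlim_ident\<close>)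
  then have "(h \<longlongrightarrow> 0 - R / (\<eta> - 1) * 0) at_top"
    unfolding h_def by (intro tendsto_intros lim)
  then have "h x \<le> 0"
    by (intro tendsto_lowerbound[of h 0 at_top])
       (auto intro: eventually_at_top_linorderI[of x] mono)
  then show ?thesis by (simp add: h_def)
qed

text \<open>Solving the tail estimate for \<open>x powr q\<close> and raising to the power
  \<open>p / q\<close> bounds the size of a value by the probability mass beyond it.\<close>

lemma powr_le_of_tail_le:
  fixes x K q t :: real
  assumes "0 < x" "0 < t" "0 < q" "0 \<le> p" and tail: "t \<le> K * x powr (- q)"
  shows "x powr p \<le> K powr (p / q) * t powr (- (p / q))"
proof -
  have "x powr q \<le> K / t"
    using tail assms by (simp add: powr_minus field_simps)
  then have "(x powr q) powr (p / q) \<le> (K / t) powr (p / q)"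
    using assms by (intro powr_mono2) auto
  also have "\<dots> = K powr (p / q) * t powr (- (p / q))"
    using assms by (subst powr_divide) (auto simp: powr_minus divide_inverse)
  finally show ?thesis
    using assms by (simp add: powr_powr)
qed

lemma ennreal_le_suminf: "g n \<le> suminf g" for g :: "nat \<Rightarrow> ennreal"
  using sum_le_suminf[of g "{n}"] by simp

text \<open>Dyadic layers: where \<open>V\<close> lies between \<open>2 powr (- (n + 1))\<close> and
  \<open>2 powr (- n)\<close>, the integrand is at most \<open>2 powr (a * (n + 1))\<close>, and the
  layer has probability at most \<open>2 powr (- n)\<close>. The products form a geometric series
  with ratio \<open>2 powr (a - 1)\<close>, which is less than 1.\<close>

lemma (in prob_space) integrable_powr_of_small_ball:
  assumes V[measurable]: "V \<in> borel_measurable M"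
    and nonneg: "\<And>\<omega>. 0 \<le> V \<omega>"
    and small: "\<And>u. 0 < u \<Longrightarrow> prob {\<omega> \<in> space M. V \<omega> < u} \<le> u"
    and a: "0 \<le> a" "a < 1"
  shows "integrable M (\<lambda>\<omega>. V \<omega> powr (- a))"
proof (rule integrableI_nonneg)
  let ?A = "\<lambda>n. {\<omega> \<in> space M. V \<omega> < 2 powr (- real n)}"
  let ?c = "\<lambda>n. 2 powr (a * (real n + 1))"
  have le: "ennreal (V \<omega> powr (- a)) \<le> 1 + (\<Sum>n. ennreal (?c n) * indicator (?A n) \<omega>)"
    if \<omega>: "\<omega> \<in> space M" for \<omega>
  proof -
    \<comment> \<open>The case \<open>V \<omega> = 0\<close> is harmless by the convention that
      \<open>0 powr (- a)\<close> is 0.\<close>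
    consider "V \<omega> = 0" | "1 \<le> V \<omega>" | "0 < V \<omega>" "V \<omega> < 1"
      using nonneg[of \<omega>] by linarith
    then show ?thesis
    proof cases
      case 2
      have "V \<omega> powr (- a) \<le> 1 powr (- a)"
        by (rule powr_mono2') (use 2 a in auto)
      then have "ennreal (V \<omega> powr (- a)) \<le> 1" by (simp add: ennreal_le_1)
      then show ?thesis by (rule order_trans) simp
    next
      case 3
      define s where "s = - log 2 (V \<omega>)"
      have V_s: "V \<omega> = 2 powr (- s)" using 3 by (simp add: s_def)
      have s: "0 < s" using 3 by (simp add: s_def)
      \<comment> \<open>The largest integer strictly below \<open>s\<close>. The floor would fail
        for integral \<open>s\<close>, where the strict inequality defining \<open>?A n\<close> is
        lost.\<close>
      define n where "n = nat (\<lceil>s\<rceil> - 1)"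
      have n: "real n < s" "s \<le> real n + 1"
        using s unfolding n_def by linarith+
      have "V \<omega> powr (- a) = 2 powr (a * s)"
        by (simp add: V_s powr_powr mult.commute)
      also have "\<dots> \<le> ?c n" using n a by (intro powr_mono mult_left_mono) auto
      finally have "ennreal (V \<omega> powr (- a)) \<le> ennreal (?c n) * indicator (?A n) \<omega>"
        using \<omega> n by (auto simp: V_s intro!: ennreal_leI)
      also have "\<dots> \<le> (\<Sum>n. ennreal (?c n) * indicator (?A n) \<omega>)"
        by (rule ennreal_le_suminf)
      finally show ?thesis by (rule order_trans) simp
    qed simp
  qed
  have "(\<integral>\<^sup>+\<omega>. ennreal (V \<omega> powr (- a)) \<partial>M)
      \<le> (\<integral>\<^sup>+\<omega>. 1 + (\<Sum>n. ennreal (?c n) * indicator (?A n) \<omega>) \<partial>M)"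
    by (rule nn_integral_mono) (rule le)
  also have "\<dots> = 1 + (\<Sum>n. ennreal (?c n) * emeasure M (?A n))"
    by (subst nn_integral_add)
       (auto simp: nn_integral_suminf nn_integral_cmult_indicator emeasure_space_1)
  also have "\<dots> \<le> 1 + (\<Sum>n. ennreal (2 powr a * (2 powr (a - 1)) ^ n))"
  proof (intro add_left_mono suminf_le allI)
    fix n
    have "?c n * prob (?A n) \<le> ?c n * 2 powr (- real n)"
      by (intro mult_left_mono small) auto
    also have "\<dots> = 2 powr a * (2 powr (a - 1)) ^ n"
      by (simp add: powr_realpow[symmetric] powr_powr powr_add[symmetric] algebra_simps)
    finally show "ennreal (?c n) * emeasure M (?A n) \<le> ennreal (2 powr a * (2 powr (a - 1)) ^ n)"
      by (simp add: emeasure_eq_measure ennreal_mult[symmetric] ennreal_leI)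
  qed auto
  also have "\<dots> < \<infinity>"
  proof -
    have "2 powr (a - 1) < 2 powr (0::real)"
      by (rule powr_less_mono) (use a in auto)
    then have "summable (\<lambda>n. 2 powr a * (2 powr (a - 1)) ^ n :: real)"
      by (intro summable_mult summable_geometric) auto
    then have "(\<Sum>n. ennreal (2 powr a * (2 powr (a - 1)) ^ n))
        = ennreal (\<Sum>n. 2 powr a * (2 powr (a - 1)) ^ n)"
      by (intro suminf_ennreal2) auto
    then show ?thesis by (simp add: ennreal_add_eq_top less_top[symmetric])
  qed
  finally show "(\<integral>\<^sup>+\<omega>. ennreal (V \<omega> powr (- a)) \<partial>M) < \<infinity>" .
qed auto

section \<open>Properties of the generalised inverse of a continuous function\<close>

lemma continuous_on_approx_cdf: "continuous_on A (approx_cdf g \<kappa> J N)"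
  unfolding approx_cdf_def[abs_def] approx_cdf_complex_def divide_inverse
  by (intro continuous_intros)

context
  fixes G :: "real \<Rightarrow> real" and D :: real
  assumes cont: "continuous_on {- D / 2..D / 2} G" and D_pos: "0 < D"
begin

text \<open>A continuous image of a compact interval is a closed interval, so the infimum and
  supremum in the definition are its end points. Level sets of values in between are nonempty and
  closed, so the infimum of such a set is attained.\<close>

lemma approx_inverse_cases:
  obtains c e where "G ` {- D / 2..D / 2} = {c..e}" "c \<le> e"
    "\<And>u. u < c \<Longrightarrow> approx_inverse G D u = - D / 2"
    "\<And>u. e < u \<Longrightarrow> approx_inverse G D u = D / 2"
    "\<And>u. c \<le> u \<Longrightarrow> u \<le> e \<Longrightarrow> approx_inverse G D u \<in> {- D / 2..D / 2}
        \<and> G (approx_inverse G D u) = u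
        \<and> (\<forall>x\<in>{- D / 2..D / 2}. G x = u \<longrightarrow> approx_inverse G D u \<le> x)"
proof -
  obtain c e where im: "G ` {- D / 2..D / 2} = {c..e}" "c \<le> e"
    using continuous_image_closed_interval[OF _ cont] D_pos by auto
  show ?thesis
  proof (rule that[OF im])
    fix u assume u: "c \<le> u" "u \<le> e"
    let ?S = "{x \<in> {- D / 2..D / 2}. G x = u}"
    have eq: "approx_inverse G D u = Inf ?S"
      using u im(2) unfolding approx_inverse_def im(1) by simp
    have "u \<in> G ` {- D / 2..D / 2}" using u im by simp
    then have ne: "?S \<noteq> {}" by auto
    have bdd: "bdd_below ?S" by (rule bdd_belowI[of _ "- D / 2"]) auto
    have "closed ?S"
      by (rule continuous_closed_preimage_constant[OF cont]) simp
    from closed_contains_Inf[OF ne bdd this] have "Inf ?S \<in> ?S" .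
    then show "approx_inverse G D u \<in> {- D / 2..D / 2}
        \<and> G (approx_inverse G D u) = u
        \<and> (\<forall>x\<in>{- D / 2..D / 2}. G x = u \<longrightarrow> approx_inverse G D u \<le> x)"
      unfolding eq using cInf_lower[OF _ bdd] by auto
  qed (use im(2) in \<open>auto simp only: approx_inverse_def im(1) cInf_atLeastAtMost cSup_atLeastAtMost split: if_split\<close>)
qed

lemma abs_approx_inverse_le: "\<bar>approx_inverse G D u\<bar> \<le> D / 2"
proof -
  obtain c e where *: "\<And>u. u < c \<Longrightarrow> approx_inverse G D u = - D / 2"
    "\<And>u. e < u \<Longrightarrow> approx_inverse G D u = D / 2"
    "\<And>u. c \<le> u \<Longrightarrow> u \<le> e \<Longrightarrow> approx_inverse G D u \<in> {- D / 2..D / 2}"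
    by (rule approx_inverse_cases) blast
  show ?thesis
    using *[of u] D_pos by (cases "u < c"; cases "e < u") (auto simp: abs_le_iff)
qed

lemma borel_measurable_approx_inverse: "approx_inverse G D \<in> borel_measurable borel"
proof (rule borel_measurableI_le)
  fix a
  obtain c e where im: "G ` {- D / 2..D / 2} = {c..e}" "c \<le> e"
    and *: "\<And>u. u < c \<Longrightarrow> approx_inverse G D u = - D / 2"
    "\<And>u. e < u \<Longrightarrow> approx_inverse G D u = D / 2"
    "\<And>u. c \<le> u \<Longrightarrow> u \<le> e \<Longrightarrow> approx_inverse G D u \<in> {- D / 2..D / 2}
        \<and> G (approx_inverse G D u) = u
        \<and> (\<forall>x\<in>{- D / 2..D / 2}. G x = u \<longrightarrow> approx_inverse G D u \<le> x)"
    by (rule approx_inverse_cases) blast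
  consider "a < - D / 2" | "D / 2 \<le> a" | "- D / 2 \<le> a" "a < D / 2" by linarith
  then show "{u \<in> space borel. approx_inverse G D u \<le> a} \<in> sets borel"
  proof cases
    case 1
    have "\<not> approx_inverse G D u \<le> a" for u
      using 1 abs_approx_inverse_le[of u] by (auto simp: abs_le_iff)
    then show ?thesis by simp
  next
    case 2
    have "approx_inverse G D u \<le> a" for u
      using 2 abs_approx_inverse_le[of u] by (auto simp: abs_le_iff)
    then show ?thesis by simp
  next
    case 3
    have "approx_inverse G D u \<le> a \<longleftrightarrow> u < c \<or> u \<in> G ` {- D / 2..a}" for u
    proof -
      consider "u < c" | "e < u" | "c \<le> u" "u \<le> e" by linarith
      then show ?thesis
      proof cases
        case 2
        have "G ` {- D / 2..a} \<subseteq> G ` {- D / 2..D / 2}" using 3 by auto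
        then have "u \<notin> G ` {- D / 2..a}" using 2 im by auto
        then show ?thesis using *(2)[OF 2] 2 3 im(2) by simp
      next
        case u: 3
        note i = *(3)[OF u]
        show ?thesis
        proof
          assume "approx_inverse G D u \<le> a"
          then show "u < c \<or> u \<in> G ` {- D / 2..a}"
            using i by (intro disjI2 image_eqI[of _ _ "approx_inverse G D u"]) auto
        next
          assume "u < c \<or> u \<in> G ` {- D / 2..a}"
          then obtain x where "u = G x" "x \<in> {- D / 2..a}" using u by auto
          then show "approx_inverse G D u \<le> a" using i 3 by force
        qed
      qed (use * 3 in auto)
    qed
    then have "{u \<in> space borel. approx_inverse G D u \<le> a} = {..<c} \<union> G ` {- D / 2..a}"
      by auto
    moreover have "compact (G ` {- D / 2..a})"
      by (rule compact_continuous_image[OF continuous_on_subset[OF cont]]) (use 3 in auto)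
    ultimately show ?thesis by (auto intro: borel_compact)
  qed
qed

text \<open>If \<open>F x\<close> is a value of \<open>G\<close>, the accuracy is applied at the
  preimage. If \<open>F x\<close> lies below all values, the preimage is the left end point, and
  \<open>F (- D / 2) \<le> F x < c \<le> G (- D / 2)\<close> squeezes the error below the accuracy
  there. The right end is symmetric.\<close>

lemma cdf_approx_inverse_close:
  assumes close: "\<And>x. x \<in> {- D / 2..D / 2} \<Longrightarrow> \<bar>F x - G x\<bar> < \<epsilon>"
    and F: "mono F" and x: "x \<in> {- D / 2..D / 2}"
  shows "\<bar>F (approx_inverse G D (F x)) - F x\<bar> < \<epsilon>"
proof -
  obtain c e where im: "G ` {- D / 2..D / 2} = {c..e}" "c \<le> e"
    and *: "\<And>u. u < c \<Longrightarrow> approx_inverse G D u = - D / 2"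
    "\<And>u. e < u \<Longrightarrow> approx_inverse G D u = D / 2"
    "\<And>u. c \<le> u \<Longrightarrow> u \<le> e \<Longrightarrow> approx_inverse G D u \<in> {- D / 2..D / 2}
        \<and> G (approx_inverse G D u) = u"
    by (rule approx_inverse_cases) blast
  have ends: "- D / 2 \<in> {- D / 2..D / 2}" "D / 2 \<in> {- D / 2..D / 2}"
    using D_pos by auto
  have G_ends: "c \<le> G (- D / 2)" "G (D / 2) \<le> e"
    using imageI[OF ends(1), of G] imageI[OF ends(2), of G] im by auto
  have F_ends: "F (- D / 2) \<le> F x" "F x \<le> F (D / 2)"
    using x by (auto intro: monoD[OF F])
  consider "F x < c" | "e < F x" | "c \<le> F x" "F x \<le> e" by linarith
  then show ?thesis
  proof cases
    case 1
    show ?thesis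
      using 1 close[OF ends(1)] G_ends(1) F_ends(1) unfolding *(1)[OF 1] by linarith
  next
    case 2
    show ?thesis
      using 2 close[OF ends(2)] G_ends(2) F_ends(2) unfolding *(2)[OF 2] by linarith
  next
    case 3
    then show ?thesis using *(3)[OF 3] close[of "approx_inverse G D (F x)"] by auto
  qed
qed

end

section \<open>The distribution of \<open>F X\<close> for a continuous distribution function
  \<open>F\<close>\<close>

locale continuous_cdf_variable = prob_space M for M :: "'a measure" +
  fixes X :: "'a \<Rightarrow> real" and F :: "real \<Rightarrow> real"
  assumes X_meas[measurable]: "X \<in> borel_measurable M"
    and cdf_X: "cdf (distr M borel X) = F"
    and cont_F: "continuous_on UNIV F"
begin

lemma real_distribution_X: "real_distribution (distr M borel X)"
  by (rule real_distribution_distr) simp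

lemma F_mono: "mono F"
  unfolding cdf_X[symmetric]
  using real_distribution.axioms(1)[OF real_distribution_X]
  by (intro monoI finite_borel_measure.cdf_nondecreasing)
     (auto intro!: finite_borel_measure.intro finite_borel_measure_axioms.intro prob_space.finite_measure)

lemma F_nonneg: "0 \<le> F x"
  unfolding cdf_X[symmetric] cdf_def by simp

lemma F_le_1: "F x \<le> 1"
  unfolding cdf_X[symmetric] cdf_def
  by (rule prob_space.prob_le_1) (rule prob_space_distr, simp)

lemma F_at_top: "(F \<longlongrightarrow> 1) at_top"
  unfolding cdf_X[symmetric] by (rule real_distribution.cdf_lim_at_top_prob[OF real_distribution_X])

lemma F_at_bot: "(F \<longlongrightarrow> 0) at_bot"
  using real_distribution.finite_borel_measure_M[OF real_distribution_X]
  unfolding cdf_X[symmetric] by (rule finite_borel_measure.cdf_lim_at_bot)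

lemma F_meas[measurable]: "F \<in> borel_measurable borel"
  by (rule borel_measurable_continuous_onI) (rule cont_F)

lemma prob_le: "prob {\<omega> \<in> space M. X \<omega> \<le> x} = F x"
  unfolding cdf_X[symmetric] cdf_def
  by (subst measure_distr) (auto intro!: arg_cong[where f=prob])

lemma F_surj:
  assumes "0 < u" "u < 1"
  obtains x where "F x = u"
proof -
  have "\<forall>\<^sub>F x in at_bot. F x < u" "\<forall>\<^sub>F x in at_top. u < F x"
    using order_tendstoD(2)[OF F_at_bot] order_tendstoD(1)[OF F_at_top] assms by auto
  then obtain a b where "F a < u" "u < F b"
    unfolding eventually_at_bot_linorder eventually_at_top_linorder by blast
  moreover from this have "a \<le> b" using monoD[OF F_mono, of b a] by linarith
  ultimately show ?thesis
    using IVT'[of F a u b] continuous_on_subset[OF cont_F] that by force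
qed

text \<open>By monotonicity the event is contained in \<open>X \<omega> \<le> x\<close> for any
  \<open>x\<close> with \<open>F x = u\<close>. Uniformity of \<open>F X\<close> enters the argument
  through this bound and its mirror image for \<open>1 - F X\<close>.\<close>

lemma prob_F_less:
  assumes "0 < u"
  shows "prob {\<omega> \<in> space M. F (X \<omega>) < u} \<le> u"
proof (cases "u < 1")
  case True
  then obtain x where x: "F x = u" using F_surj assms by blast
  have "y \<le> x" if "F y < u" for y
    using that x monoD[OF F_mono, of x y] by linarith
  then have "prob {\<omega> \<in> space M. F (X \<omega>) < u} \<le> prob {\<omega> \<in> space M. X \<omega> \<le> x}"
    by (intro finite_measure_mono) auto
  then show ?thesis by (simp add: prob_le x)
next
  case False
  then show ?thesis using prob_le_1[of "{\<omega> \<in> space M. F (X \<omega>) < u}"] by linarith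
qed

lemma prob_F_greater:
  assumes "0 < u"
  shows "prob {\<omega> \<in> space M. 1 - F (X \<omega>) < u} \<le> u"
proof (cases "u < 1")
  case True
  then obtain x where x: "F x = 1 - u" using F_surj[of "1 - u"] assms by auto
  have "\<not> y \<le> x" if "1 - F y < u" for y
    using that x monoD[OF F_mono, of y x] by linarith
  then have "prob {\<omega> \<in> space M. 1 - F (X \<omega>) < u} \<le> prob {\<omega> \<in> space M. \<not> X \<omega> \<le> x}"
    by (intro finite_measure_mono) auto
  also have "\<dots> = 1 - F x"
    by (subst prob_neg) (auto simp: prob_le)
  finally show ?thesis by (simp add: x)
next
  case False
  then show ?thesis using prob_le_1[of "{\<omega> \<in> space M. 1 - F (X \<omega>) < u}"] by linarith
qed

text \<open>\<open>F X\<close> has no atoms. \<open>?N\<close> and \<open>?B'\<close> are disjoint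
  subsets of \<open>?A\<close>, so \<open>prob ?N \<le> prob ?A + prob ?B - 1\<close>, and the two
  one-sided bounds leave at most \<open>e\<close>.\<close>

lemma AE_F_neq: "AE \<omega> in M. F (X \<omega>) \<noteq> u"
proof -
  let ?N = "{\<omega> \<in> space M. F (X \<omega>) = u}"
  have "prob ?N \<le> e" if e: "0 < e" for e
  proof -
    consider "u < 0 \<or> 1 < u" | "0 \<le> u" "u \<le> 1" by linarith
    then show ?thesis
    proof cases
      case 1
      then have "F (X \<omega>) \<noteq> u" for \<omega> using F_nonneg[of "X \<omega>"] F_le_1[of "X \<omega>"] by linarith
      then have "?N = {}" by simp
      then show ?thesis using e by (simp only: measure_empty)
    next
      case 2
      let ?A = "{\<omega> \<in> space M. F (X \<omega>) < u + e / 2}"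
      let ?B = "{\<omega> \<in> space M. 1 - F (X \<omega>) < 1 - u + e / 2}"
      let ?B' = "{\<omega> \<in> space M. \<not> 1 - F (X \<omega>) < 1 - u + e / 2}"
      have "prob ?N + prob ?B' = prob (?N \<union> ?B')"
        by (rule finite_measure_Union[symmetric]) (use e in auto)
      also have "\<dots> \<le> prob ?A"
        by (rule finite_measure_mono) (use e in auto)
      also have "\<dots> \<le> u + e / 2" by (rule prob_F_less) (use 2 e in simp)
      finally have "prob ?N + prob ?B' \<le> u + e / 2" .
      moreover have "prob ?B' = 1 - prob ?B" by (rule prob_neg) simp
      moreover have "prob ?B \<le> 1 - u + e / 2"
        by (rule prob_F_greater) (use 2 e in simp)
      ultimately show ?thesis by simp
    qed
  qed
  then have "prob ?N = 0"
    using field_le_epsilon[of "prob ?N" 0] measure_nonneg[of M ?N] by simp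
  then have "emeasure M ?N = 0" by (simp add: emeasure_eq_measure)
  then show ?thesis by (intro AE_I[of _ _ ?N]) auto
qed


text \<open>This turns closeness of values of \<open>F\<close> into closeness of arguments. A
  rational on each side of \<open>X \<omega>\<close> separates the values, once
  \<open>F (X \<omega>)\<close> avoids the countable image of the rationals.\<close>

lemma AE_F_strict: "AE \<omega> in M. \<forall>\<delta>>0. F (X \<omega> - \<delta>) < F (X \<omega>) \<and> F (X \<omega>) < F (X \<omega> + \<delta>)"
proof -
  have "AE \<omega> in M. \<forall>r\<in>\<rat>. F (X \<omega>) \<noteq> F r"
    by (subst AE_ball_countable[OF countable_rat]) (intro ballI AE_F_neq)
  then show ?thesis
  proof eventually_elim
    case (elim \<omega>)
    show ?case
    proof (intro allI impI)
      fix \<delta> :: real assume "0 < \<delta>"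
      then obtain r s where rs: "r \<in> \<rat>" "X \<omega> - \<delta> < r" "r < X \<omega>" "s \<in> \<rat>" "X \<omega> < s" "s < X \<omega> + \<delta>"
        using Rats_dense_in_real[of "X \<omega> - \<delta>" "X \<omega>"] Rats_dense_in_real[of "X \<omega>" "X \<omega> + \<delta>"] by auto
      then have "F (X \<omega> - \<delta>) \<le> F r" "F r \<le> F (X \<omega>)" "F (X \<omega>) \<le> F s" "F s \<le> F (X \<omega> + \<delta>)"
        by (auto intro: monoD[OF F_mono])
      moreover have "F (X \<omega>) \<noteq> F r" "F (X \<omega>) \<noteq> F s" using elim rs by auto
      ultimately show "F (X \<omega> - \<delta>) < F (X \<omega>) \<and> F (X \<omega>) < F (X \<omega> + \<delta>)" by linarith
    qed
  qed
qed

end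

section \<open>Polynomial tails: domination and convergence of the error\<close>

locale polynomial_tail_variable = continuous_cdf_variable +
  fixes K q p :: real
  assumes p_pos: "0 < p" and p_less: "p < q"
    and tail_left: "\<And>x. 0 < x \<Longrightarrow> F (- x) \<le> K * x powr (- q)"
    and tail_right: "\<And>x. 0 < x \<Longrightarrow> 1 - F x \<le> K * x powr (- q)"
begin

text \<open>A majorant of \<open>\<bar>x\<bar> powr p\<close> as a function of
  \<open>u = F x\<close>: the first summand controls the left tail, the second the right one. Since
  \<open>p / q < 1\<close>, it is integrable at \<open>u = F X\<close>.\<close>

definition tail_bound :: "real \<Rightarrow> real" where
  "tail_bound u = K powr (p / q) * (u powr (- (p / q)) + (1 - u) powr (- (p / q)))"

lemma tail_bound_nonneg: "0 \<le> tail_bound u"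
  unfolding tail_bound_def by simp

text \<open>Each sign of \<open>x\<close> uses its own tail. The bounds on \<open>F x\<close>
  exclude the values where a \<open>powr\<close> with base 0 evaluates to 0 and the majorant would
  be too small.\<close>

lemma abs_powr_le_tail_bound:
  assumes "0 < F x" "F x < 1"
  shows "\<bar>x\<bar> powr p \<le> tail_bound (F x)"
proof -
  consider "x = 0" | "0 < x" | "x < 0" by linarith
  then show ?thesis
  proof cases
    case 1
    then show ?thesis using tail_bound_nonneg p_pos by simp
  next
    case 2
    have "x powr p \<le> K powr (p / q) * (1 - F x) powr (- (p / q))"
      by (rule powr_le_of_tail_le) (use 2 assms p_pos p_less tail_right in auto)
    then show ?thesis using 2 unfolding tail_bound_def
      by (simp add: distrib_left add_increasing)
  next
    case 3
    have "(- x) powr p \<le> K powr (p / q) * F x powr (- (p / q))"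
      by (rule powr_le_of_tail_le) (use 3 assms p_pos p_less tail_left[of "- x"] in auto)
    then show ?thesis using 3 unfolding tail_bound_def
      by (simp add: distrib_left add_increasing2)
  qed
qed

lemma tail_bound_half:
  assumes u: "0 < u" "u < 1" and v: "u / 2 \<le> v" "(1 - u) / 2 \<le> 1 - v"
  shows "tail_bound v \<le> 2 powr (p / q) * tail_bound u"
proof -
  have *: "t powr (- (p / q)) \<le> 2 powr (p / q) * s powr (- (p / q))" if "0 < s" "s / 2 \<le> t" for s t
  proof -
    have "t powr (- (p / q)) \<le> (s / 2) powr (- (p / q))"
      by (rule powr_mono2') (use that p_pos p_less in auto)
    also have "\<dots> = 2 powr (p / q) * s powr (- (p / q))"
      using that by (simp add: powr_divide powr_minus field_simps)
    finally show ?thesis .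
  qed
  have "tail_bound v \<le> K powr (p / q) *
      (2 powr (p / q) * u powr (- (p / q)) + 2 powr (p / q) * (1 - u) powr (- (p / q)))"
    unfolding tail_bound_def by (intro mult_left_mono add_mono *) (use u v in auto)
  then show ?thesis by (simp add: tail_bound_def algebra_simps)
qed

lemma AE_F_bounds: "AE \<omega> in M. 0 < F (X \<omega>) \<and> F (X \<omega>) < 1"
  using AE_F_neq[of 0] AE_F_neq[of 1]
proof eventually_elim
  case (elim \<omega>)
  then show ?case using F_nonneg[of "X \<omega>"] F_le_1[of "X \<omega>"] by linarith
qed

lemma integrable_tail_bound: "integrable M (\<lambda>\<omega>. tail_bound (F (X \<omega>)))"
  unfolding tail_bound_def
  by (intro integrable_mult_right Bochner_Integration.integrable_add integrable_powr_of_small_ball)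
     (use p_pos p_less F_nonneg F_le_1 prob_F_less prob_F_greater in auto)

lemma integrable_abs_powr: "integrable M (\<lambda>\<omega>. \<bar>X \<omega>\<bar> powr p)"
proof (rule Bochner_Integration.integrable_bound[OF integrable_tail_bound])
  show "AE \<omega> in M. norm (\<bar>X \<omega>\<bar> powr p) \<le> norm (tail_bound (F (X \<omega>)))"
    using AE_F_bounds
    by eventually_elim (use abs_powr_le_tail_bound tail_bound_nonneg in auto)
qed simp

text \<open>The inverse is bounded by \<open>D / 2\<close>, so the moment of \<open>X\<close>
  suffices. A Bochner integral of a non-integrable function is 0, so a limit of integrals describes
  expectations only together with this fact.\<close>

lemma integrable_approx_inverse_error:
  assumes cont: "continuous_on {- D / 2..D / 2} G" and D: "0 < D"
  shows "integrable M (\<lambda>\<omega>. \<bar>approx_inverse G D (F (X \<omega>)) - X \<omega>\<bar> powr p)"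
proof (rule Bochner_Integration.integrable_bound)
  note [measurable] = borel_measurable_approx_inverse[OF cont D]
  show "integrable M (\<lambda>\<omega>. 2 powr p * ((D / 2) powr p + \<bar>X \<omega>\<bar> powr p))"
    by (intro integrable_mult_right Bochner_Integration.integrable_add integrable_abs_powr) simp
  show "(\<lambda>\<omega>. \<bar>approx_inverse G D (F (X \<omega>)) - X \<omega>\<bar> powr p) \<in> borel_measurable M"
    by measurable
  have "\<bar>approx_inverse G D u - x\<bar> powr p \<le> 2 powr p * ((D / 2) powr p + \<bar>x\<bar> powr p)" for u x
  proof -
    have "\<bar>approx_inverse G D u\<bar> powr p \<le> (D / 2) powr p"
      by (rule powr_mono2) (use abs_approx_inverse_le[OF cont D] p_pos in auto)
    then show ?thesis
      using abs_diff_powr_le[of p "approx_inverse G D u" x] p_pos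
      by (smt (verit) mult_left_mono powr_ge_zero)
  qed
  then show "AE \<omega> in M. norm (\<bar>approx_inverse G D (F (X \<omega>)) - X \<omega>\<bar> powr p)
      \<le> norm (2 powr p * ((D / 2) powr p + \<bar>X \<omega>\<bar> powr p))"
    by simp
qed

text \<open>Stated along sequences to suit dominated convergence. \<open>D\<epsilon>_lim\<close>
  handles the exceptional event, where the error is at most \<open>D n\<close> and the probability
  at most \<open>4 * \<epsilon> n\<close>.\<close>

lemma approx_inverse_error_tendsto_0:
  fixes G :: "nat \<Rightarrow> real \<Rightarrow> real" and D \<epsilon> :: "nat \<Rightarrow> real"
  assumes cont: "\<And>n. continuous_on {- D n / 2..D n / 2} (G n)"
    and D_pos: "\<And>n. 0 < D n" and \<epsilon>_pos: "\<And>n. 0 < \<epsilon> n"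
    and close: "\<And>n x. x \<in> {- D n / 2..D n / 2} \<Longrightarrow> \<bar>F x - G n x\<bar> < \<epsilon> n"
    and \<epsilon>_lim: "\<epsilon> \<longlonglongrightarrow> 0" and D_lim: "filterlim D at_top sequentially"
    and D\<epsilon>_lim: "(\<lambda>n. D n powr p * \<epsilon> n) \<longlonglongrightarrow> 0"
  shows "(\<lambda>n. \<integral>\<omega>. \<bar>approx_inverse (G n) (D n) (F (X \<omega>)) - X \<omega>\<bar> powr p \<partial>M) \<longlonglongrightarrow> 0"
proof -
  define Y where "Y n \<omega> = approx_inverse (G n) (D n) (F (X \<omega>))" for n \<omega>
  have [measurable]: "Y n \<in> borel_measurable M" for n
    using borel_measurable_approx_inverse[OF cont D_pos]
    unfolding Y_def[abs_def] by (rule measurable_compose[rotated]) simp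
  define Z where "Z n \<omega> = \<bar>Y n \<omega> - X \<omega>\<bar> powr p" for n \<omega>
  have int_Z: "integrable M (Z n)" for n
    unfolding Z_def[abs_def] Y_def by (rule integrable_approx_inverse_error[OF cont D_pos])
  \<comment> \<open>The event not covered by dominated convergence: an error of at most \<open>\<epsilon> n\<close> in \<open>F\<close> is large
    relative to the mass of the tail beyond \<open>X\<close>.\<close>
  define near where "near n = {\<omega> \<in> space M. \<bar>X \<omega>\<bar> \<le> D n / 2 \<and>
      (F (X \<omega>) < 2 * \<epsilon> n \<or> 1 - F (X \<omega>) < 2 * \<epsilon> n)}" for n
  have [measurable]: "near n \<in> sets M" for n unfolding near_def by measurable
  define W where "W n \<omega> = Z n \<omega> * indicator (space M - near n) \<omega>" for n \<omega>
  have Y_le: "\<bar>Y n \<omega>\<bar> \<le> D n / 2" for n \<omega>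
    unfolding Y_def by (rule abs_approx_inverse_le[OF cont D_pos])
  have F_Y: "\<bar>F (Y n \<omega>) - F (X \<omega>)\<bar> < \<epsilon> n" if "\<bar>X \<omega>\<bar> \<le> D n / 2" for n \<omega>
    unfolding Y_def
    by (rule cdf_approx_inverse_close[OF cont D_pos close F_mono])
       (use that in \<open>auto simp: abs_le_iff\<close>)
  \<comment> \<open>Lets the case of \<open>X\<close> outside the interval share the constant of the
    case inside.\<close>
  have two_powr: "1 \<le> 2 powr (p / q)"
    using p_pos p_less by (intro ge_one_powr_ge_zero) auto
  have Z_le: "Z n \<omega> \<le> 2 powr p * ((2 powr (p / q) + 1) * tail_bound (F (X \<omega>)))"
    if \<omega>: "\<omega> \<in> space M" "\<omega> \<notin> near n" and F01: "0 < F (X \<omega>)" "F (X \<omega>) < 1" for n \<omega>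
  proof -
    have X_le: "\<bar>X \<omega>\<bar> powr p \<le> tail_bound (F (X \<omega>))"
      by (rule abs_powr_le_tail_bound[OF F01])
    have "\<bar>Y n \<omega>\<bar> powr p \<le> 2 powr (p / q) * tail_bound (F (X \<omega>))"
    proof (cases "\<bar>X \<omega>\<bar> \<le> D n / 2")
      case True
      have "2 * \<epsilon> n \<le> F (X \<omega>)" "2 * \<epsilon> n \<le> 1 - F (X \<omega>)"
        using \<omega> True by (auto simp: near_def)
      \<comment> \<open>\<open>\<epsilon> n\<close> is at most half of \<open>F X\<close> and of
        \<open>1 - F X\<close>, so a shift by less than \<open>\<epsilon> n\<close> keeps half of
        each. Hence \<open>F Y\<close> stays strictly between 0 and 1, and the majorant applies at
        \<open>Y\<close>.\<close>
      then have half: "F (X \<omega>) / 2 \<le> F (Y n \<omega>)" "(1 - F (X \<omega>)) / 2 \<le> 1 - F (Y n \<omega>)"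
        using F_Y[OF True] by (auto simp: abs_less_iff field_simps)
      then have "\<bar>Y n \<omega>\<bar> powr p \<le> tail_bound (F (Y n \<omega>))"
        by (intro abs_powr_le_tail_bound) (use F01 in auto)
      also have "\<dots> \<le> 2 powr (p / q) * tail_bound (F (X \<omega>))"
        by (rule tail_bound_half[OF F01 half])
      finally show ?thesis .
    next
      case False
      have "\<bar>Y n \<omega>\<bar> powr p \<le> \<bar>X \<omega>\<bar> powr p"
        by (rule powr_mono2) (use False Y_le[of n \<omega>] p_pos in auto)
      also have "\<dots> \<le> 1 * tail_bound (F (X \<omega>))" using X_le by simp
      also have "\<dots> \<le> 2 powr (p / q) * tail_bound (F (X \<omega>))"
        by (rule mult_right_mono[OF two_powr tail_bound_nonneg])
      finally show ?thesis .
    qed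
    then have "\<bar>Y n \<omega>\<bar> powr p + \<bar>X \<omega>\<bar> powr p \<le> (2 powr (p / q) + 1) * tail_bound (F (X \<omega>))"
      using X_le by (simp add: distrib_right)
    then have "2 powr p * (\<bar>Y n \<omega>\<bar> powr p + \<bar>X \<omega>\<bar> powr p)
        \<le> 2 powr p * ((2 powr (p / q) + 1) * tail_bound (F (X \<omega>)))"
      by (intro mult_left_mono) auto
    then show ?thesis
      unfolding Z_def using abs_diff_powr_le[of p "Y n \<omega>" "X \<omega>"] p_pos by linarith
  qed
  have Y_lim: "AE \<omega> in M. (\<lambda>n. Y n \<omega>) \<longlonglongrightarrow> X \<omega>"
    using AE_F_strict
  proof eventually_elim
    case (elim \<omega>)
    have inside: "\<forall>\<^sub>F n in sequentially. 2 * \<bar>X \<omega>\<bar> \<le> D n"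
      using D_lim by (simp add: filterlim_at_top)
    show ?case
    proof (rule tendstoI)
      fix \<delta> :: real assume \<delta>: "0 < \<delta>"
      \<comment> \<open>The smaller gap of \<open>F\<close> at distance \<open>\<delta>\<close> on
        either side. By monotonicity, a value of \<open>F\<close> less than \<open>e\<close> away
        from \<open>F X\<close> forces its argument within \<open>\<delta>\<close> of
        \<open>X\<close>.\<close>
      define e where "e = min (F (X \<omega>) - F (X \<omega> - \<delta>)) (F (X \<omega> + \<delta>) - F (X \<omega>))"
      have "0 < e" using elim \<delta> by (simp add: e_def)
      then have "\<forall>\<^sub>F n in sequentially. \<epsilon> n < e" by (rule order_tendstoD(2)[OF \<epsilon>_lim])
      with inside show "\<forall>\<^sub>F n in sequentially. dist (Y n \<omega>) (X \<omega>) < \<delta>"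
      proof eventually_elim
        case (elim n)
        have "\<bar>F (Y n \<omega>) - F (X \<omega>)\<bar> < e" using F_Y[of \<omega> n] elim by simp
        then have "F (X \<omega> - \<delta>) < F (Y n \<omega>)" "F (Y n \<omega>) < F (X \<omega> + \<delta>)"
          by (auto simp: e_def)
        then have "X \<omega> - \<delta> < Y n \<omega>" "Y n \<omega> < X \<omega> + \<delta>"
          using monoD[OF F_mono] by (meson not_less)+
        then show ?case by (simp add: dist_real_def abs_less_iff)
      qed
    qed
  qed
  have W_lim: "(\<lambda>n. \<integral>\<omega>. W n \<omega> \<partial>M) \<longlonglongrightarrow> (\<integral>\<omega>. 0 \<partial>M)"
  proof (rule integral_dominated_convergence)
    show "integrable M (\<lambda>\<omega>. 2 powr p * ((2 powr (p / q) + 1) * tail_bound (F (X \<omega>))))"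
      by (intro integrable_mult_right integrable_tail_bound)
    show "AE \<omega> in M. norm (W n \<omega>) \<le> 2 powr p * ((2 powr (p / q) + 1) * tail_bound (F (X \<omega>)))" for n
      using AE_F_bounds AE_space
    proof eventually_elim
      case (elim \<omega>)
      then show ?case
        using Z_le[of \<omega> n] tail_bound_nonneg[of "F (X \<omega>)"]
        by (cases "\<omega> \<in> near n") (auto simp: W_def Z_def)
    qed
    show "AE \<omega> in M. (\<lambda>n. W n \<omega>) \<longlonglongrightarrow> 0"
      using Y_lim
    proof eventually_elim
      case (elim \<omega>)
      \<comment> \<open>The base tends to 0, where continuity of \<open>powr\<close> in the base
        relies on the positive exponent.\<close>
      have "(\<lambda>n. Z n \<omega>) \<longlonglongrightarrow> \<bar>X \<omega> - X \<omega>\<bar> powr p"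
        unfolding Z_def by (intro tendsto_powr' tendsto_intros elim) (use p_pos in auto)
      then have "(\<lambda>n. Z n \<omega>) \<longlonglongrightarrow> 0" using p_pos by simp
      then show ?case
        by (rule Lim_null_comparison[rotated])
           (auto simp: W_def Z_def indicator_def)
    qed
  qed (simp_all add: W_def[abs_def] Z_def)
  have Z_bound: "(\<integral>\<omega>. Z n \<omega> \<partial>M) \<le> (\<integral>\<omega>. W n \<omega> \<partial>M) + 4 * (D n powr p * \<epsilon> n)" for n
  proof -
    let ?A = "{\<omega> \<in> space M. F (X \<omega>) < 2 * \<epsilon> n}" and ?B = "{\<omega> \<in> space M. 1 - F (X \<omega>) < 2 * \<epsilon> n}"
    have int_W: "integrable M (W n)"
      unfolding W_def[abs_def] by (rule integrable_real_mult_indicator[OF _ int_Z]) simp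
    have int_AB: "integrable M (\<lambda>\<omega>. D n powr p * (indicator ?A \<omega> + indicator ?B \<omega>))"
      by (intro integrable_mult_right Bochner_Integration.integrable_add integrable_real_indicator)
         (auto simp: less_top[symmetric])
    have "(\<integral>\<omega>. Z n \<omega> \<partial>M)
        \<le> (\<integral>\<omega>. W n \<omega> + D n powr p * (indicator ?A \<omega> + indicator ?B \<omega>) \<partial>M)"
    proof (rule integral_mono[OF int_Z Bochner_Integration.integrable_add[OF int_W int_AB]])
      fix \<omega> assume \<omega>: "\<omega> \<in> space M"
      show "Z n \<omega> \<le> W n \<omega> + D n powr p * (indicator ?A \<omega> + indicator ?B \<omega>)"
      proof (cases "\<omega> \<in> near n")
        case True
        \<comment> \<open>On \<open>near n\<close> both \<open>X\<close> and \<open>Y\<close> lie in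
          an interval of length \<open>D n\<close>, and at least one of the two indicators is
          1.\<close>
        have "Z n \<omega> \<le> D n powr p * 1"
          unfolding Z_def mult_1_right
          by (rule powr_mono2) (use True Y_le[of n \<omega>] p_pos in \<open>auto simp: near_def\<close>)
        also have "\<dots> \<le> D n powr p * (indicator ?A \<omega> + indicator ?B \<omega>)"
          by (intro mult_left_mono) (use True in \<open>auto simp: near_def indicator_def\<close>)
        finally show ?thesis using True by (simp add: W_def)
      next
        case False
        then show ?thesis using \<omega> by (simp add: W_def)
      qed
    qed
    also have "\<dots> = (\<integral>\<omega>. W n \<omega> \<partial>M) + D n powr p * (prob ?A + prob ?B)"
      by (subst Bochner_Integration.integral_add[OF int_W int_AB])
         (subst integral_mult_right_zero, subst Bochner_Integration.integral_add,
          auto simp: less_top[symmetric] intro!: integrable_real_indicator)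
    also have "\<dots> \<le> (\<integral>\<omega>. W n \<omega> \<partial>M) + D n powr p * (2 * \<epsilon> n + 2 * \<epsilon> n)"
      using \<epsilon>_pos[of n]
      by (intro add_left_mono mult_left_mono add_mono prob_F_less prob_F_greater) auto
    finally show ?thesis by (simp add: algebra_simps)
  qed
  have upper: "(\<lambda>n. (\<integral>\<omega>. W n \<omega> \<partial>M) + 4 * (D n powr p * \<epsilon> n)) \<longlonglongrightarrow> 0 + 4 * 0"
    using W_lim by (intro tendsto_intros D\<epsilon>_lim) simp
  have "(\<lambda>n. \<integral>\<omega>. Z n \<omega> \<partial>M) \<longlonglongrightarrow> 0"
  proof (rule tendsto_sandwich[OF _ _ tendsto_const])
    show "\<forall>\<^sub>F n in sequentially. 0 \<le> (\<integral>\<omega>. Z n \<omega> \<partial>M)"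
      by (simp add: Z_def)
    show "\<forall>\<^sub>F n in sequentially. (\<integral>\<omega>. Z n \<omega> \<partial>M) \<le> (\<integral>\<omega>. W n \<omega> \<partial>M) + 4 * (D n powr p * \<epsilon> n)"
      by (simp add: Z_bound)
    show "(\<lambda>n. (\<integral>\<omega>. W n \<omega> \<partial>M) + 4 * (D n powr p * \<epsilon> n)) \<longlonglongrightarrow> 0"
      using upper by simp
  qed
  then show ?thesis by (simp add: Z_def Y_def)
qed

end

section \<open>Application to the increment of the Levy process\<close>

theorem theorem3p16:
  fixes P :: "'a measure" and \<l> :: "real \<Rightarrow> 'a \<Rightarrow> real"
    and \<phi> :: "real \<Rightarrow> complex" and \<Delta> :: real
    and \<mu> :: "real measure" and F f :: "real \<Rightarrow> real"
    and R \<eta> B \<theta> C d :: real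
    and D \<kappa> J :: "real \<Rightarrow> real" and M :: "real \<Rightarrow> nat"
    and X U :: "'a \<Rightarrow> real" and X_approx :: "real \<Rightarrow> 'a \<Rightarrow> real"
  assumes levy: "levy_process P \<l>"
    and \<phi>: "\<phi> = char (distr P borel (\<l> 1))"
    and \<Delta>: "\<Delta> > 0"
    and \<mu>: "real_distribution \<mu>" "char \<mu> = cf_power \<phi> \<Delta>"
    and F: "F = cdf \<mu>"
    and density: "\<forall>x. (F has_real_derivative f x) (at x)" "continuous_on UNIV f"
    and constants: "R > 0" "\<eta> > 2" "B > 0" "\<theta> > 0"
    and density_bound: "\<forall>x. x \<noteq> 0 \<longrightarrow> \<bar>f x\<bar> \<le> R * \<bar>x\<bar> powr (- \<eta>)"
    and cf_bound: "\<forall>u. u \<noteq> 0 \<longrightarrow> cmod (cf_power \<phi> \<Delta> u) \<le> B * \<bar>u / (2 * pi)\<bar> powr (- \<theta>)"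
    and X: "X \<in> borel_measurable P" "cdf (distr P borel X) = F"
    and D: "C > 0" "d > 0" "\<forall>\<epsilon>>0. D \<epsilon> = C * \<epsilon> powr (- d)"
    and parameters:
      "\<forall>\<epsilon>>0. 0 < \<kappa> \<epsilon> \<and> \<kappa> \<epsilon> < 2 / 3 \<and> J \<epsilon> \<ge> D \<epsilon> / \<kappa> \<epsilon> \<and> even (M \<epsilon>)"
    and accuracy:
      "\<forall>\<epsilon>>0. \<forall>x\<in>{- D \<epsilon> / 2..D \<epsilon> / 2}.
         \<bar>F x - approx_cdf (cf_power \<phi> \<Delta>) (\<kappa> \<epsilon>) (J \<epsilon>) (M \<epsilon>) x\<bar> < \<epsilon>"
    and U: "U = (\<lambda>\<omega>. F (X \<omega>))"
    and X_approx: "\<forall>\<epsilon>>0. X_approx \<epsilon> = (\<lambda>\<omega>.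
      approx_inverse (approx_cdf (cf_power \<phi> \<Delta>) (\<kappa> \<epsilon>) (J \<epsilon>) (M \<epsilon>)) (D \<epsilon>) (U \<omega>))"
  shows "\<forall>p. 1 \<le> p \<and> p < \<eta> - 1 \<and> d < 1 / p \<longrightarrow>
     (\<forall>\<epsilon>>0. integrable P (\<lambda>\<omega>. \<bar>X_approx \<epsilon> \<omega> - X \<omega>\<bar> powr p)) \<and>
     ((\<lambda>\<epsilon>. \<integral>\<omega>. \<bar>X_approx \<epsilon> \<omega> - X \<omega>\<bar> powr p \<partial>P) \<longlongrightarrow> 0) (at_right 0)"
proof (intro allI impI)
  fix p assume p: "1 \<le> p \<and> p < \<eta> - 1 \<and> d < 1 / p"
  interpret prob_space P
    using levy by (rule levy_process.axioms(1))
  have cont: "continuous_on UNIV F"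
    using density(1) by (intro continuous_at_imp_continuous_on) (auto intro: DERIV_isCont)
  interpret X: continuous_cdf_variable P X F
    by unfold_locales (use X cont in auto)
  \<comment> \<open>The constant obtained by integrating \<open>R * x powr (- \<eta>)\<close> over a
    tail, which lowers the exponent to \<open>\<eta> - 1\<close>. The left tail is treated by
    reflection.\<close>
  define K where "K = R / (\<eta> - 1)"
  interpret X: polynomial_tail_variable P X F K "\<eta> - 1" p
  proof
    fix x :: real assume x: "0 < x"
    show "F (- x) \<le> K * x powr (- (\<eta> - 1))" unfolding K_def
    proof (rule tail_le_powr_of_deriv[where T = "\<lambda>x. F (- x)" and T' = "\<lambda>x. - f (- x)"])
      show "((\<lambda>x. F (- x)) has_real_derivative - f (- y)) (at y)" for y
        using DERIV_mirror[of F "f (- y)" y] density(1) by auto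
      show "\<bar>- f (- y)\<bar> \<le> R * y powr (- \<eta>)" if "0 < y" for y
        using density_bound[rule_format, of "- y"] that by simp
      show "((\<lambda>x. F (- x)) \<longlongrightarrow> 0) at_top"
        by (rule filterlim_compose[OF X.F_at_bot filterlim_uminus_at_bot_at_top])
    qed (use constants x in auto)
    show "1 - F x \<le> K * x powr (- (\<eta> - 1))" unfolding K_def
    proof (rule tail_le_powr_of_deriv[where T' = "\<lambda>x. - f x"])
      show "((\<lambda>x. 1 - F x) has_real_derivative - f y) (at y)" for y
        using DERIV_diff[OF DERIV_const density(1)[rule_format, of y], of 1] by simp
      show "\<bar>- f y\<bar> \<le> R * y powr (- \<eta>)" if "0 < y" for y
        using density_bound[rule_format, of y] that by simp
      show "((\<lambda>x. 1 - F x) \<longlongrightarrow> 0) at_top"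
        using tendsto_diff[OF tendsto_const X.F_at_top, of 1] by simp
    qed (use constants x in auto)
  qed (use p in auto)
  have D_pos: "0 < D \<epsilon>" if "0 < \<epsilon>" for \<epsilon>
    using D that by simp
  have X_approx': "X_approx \<epsilon> = (\<lambda>\<omega>. approx_inverse
      (approx_cdf (cf_power \<phi> \<Delta>) (\<kappa> \<epsilon>) (J \<epsilon>) (M \<epsilon>)) (D \<epsilon>) (F (X \<omega>)))" if "0 < \<epsilon>" for \<epsilon>
    using X_approx that by (simp add: U)
  have int: "integrable P (\<lambda>\<omega>. \<bar>X_approx \<epsilon> \<omega> - X \<omega>\<bar> powr p)" if "0 < \<epsilon>" for \<epsilon>
    unfolding X_approx'[OF that]
    by (rule X.integrable_approx_inverse_error[OF continuous_on_approx_cdf D_pos[OF that]])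
  have lim: "((\<lambda>\<epsilon>. \<integral>\<omega>. \<bar>X_approx \<epsilon> \<omega> - X \<omega>\<bar> powr p \<partial>P) \<longlongrightarrow> 0) (at_right 0)"
  \<comment> \<open>The one-sided limit is tested along sequences; 1 is an arbitrary right end
    point.\<close>
  proof (rule tendsto_at_right_sequentially[of 0 1])
    fix S :: "nat \<Rightarrow> real"
    assume S_pos: "\<And>n. 0 < S n" and S_lim: "S \<longlonglongrightarrow> 0"
    have S_right: "filterlim S (at_right 0) sequentially"
      using S_pos S_lim by (auto simp: filterlim_at less_imp_neq[symmetric])
    have dp: "d * p < 1" using p pos_less_divide_eq[of p d 1] by simp
    have "(\<lambda>n. \<integral>\<omega>. \<bar>approx_inverse (approx_cdf (cf_power \<phi> \<Delta>) (\<kappa> (S n)) (J (S n)) (M (S n)))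
        (D (S n)) (F (X \<omega>)) - X \<omega>\<bar> powr p \<partial>P) \<longlonglongrightarrow> 0"
    proof (rule X.approx_inverse_error_tendsto_0[where \<epsilon> = S])
      have "filterlim (\<lambda>x::real. C * x powr (- d)) at_top (at_right 0)"
        using D(1,2) by real_asymp
      from filterlim_compose[OF this S_right]
      show "filterlim (\<lambda>n. D (S n)) at_top sequentially"
        using D(3) S_pos by simp
      \<comment> \<open>Inserting the formula for \<open>D\<close> gives
        \<open>C powr p * \<epsilon> powr (1 - d * p)\<close> for the contribution
        \<open>D powr p * \<epsilon>\<close>. Its exponent is positive exactly because
        \<open>d < 1 / p\<close>.\<close>
      have "((\<lambda>x. C powr p * x powr (1 - d * p)) \<longlongrightarrow> C powr p * 0) (at_right 0)"
        using dp by (intro tendsto_intros) real_asymp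
      from filterlim_compose[OF this S_right]
      have "(\<lambda>n. C powr p * S n powr (1 - d * p)) \<longlonglongrightarrow> 0" by simp
      moreover have "C powr p * S n powr (1 - d * p) = D (S n) powr p * S n" for n
      proof -
        have "S n powr (1 - d * p) = S n powr (- (d * p)) * S n"
          using S_pos[of n] powr_add[of "S n" "- (d * p)" 1] by simp
        then show ?thesis
          using D(3) S_pos[of n] by (simp add: powr_mult powr_powr)
      qed
      ultimately show "(\<lambda>n. D (S n) powr p * S n) \<longlonglongrightarrow> 0" by simp
    qed (use S_pos S_lim D_pos accuracy continuous_on_approx_cdf in auto)
    then show "(\<lambda>n. \<integral>\<omega>. \<bar>X_approx (S n) \<omega> - X \<omega>\<bar> powr p \<partial>P) \<longlonglongrightarrow> 0"
      using X_approx'[OF S_pos] by simp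
  qed simp
  show "(\<forall>\<epsilon>>0. integrable P (\<lambda>\<omega>. \<bar>X_approx \<epsilon> \<omega> - X \<omega>\<bar> powr p)) \<and>
     ((\<lambda>\<epsilon>. \<integral>\<omega>. \<bar>X_approx \<epsilon> \<omega> - X \<omega>\<bar> powr p \<partial>P) \<longlongrightarrow> 0) (at_right 0)"
    using int lim by blast
qed

end
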